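(* Let $G=\prod_{l=1}^{t}\mathbb{Z}/n_l\mathbb{Z}$ be a finite abelian group of order $v$, and let $k,\lambda$ be integers. Let $J$ be the ideal of the polynomial ring $\mathbb{C}[A]=\mathbb{C}[A_g : g\in G]$ generated by the polynomials $\Psi(\xi,A)$ for all $\xi\in U$ and $P_g(A)=A_g^2-A_g$ for all $g\in G$. Then the number of $(v,k,\lambda)$-difference sets in $G$ equals ${}^aHP_J(s)$ for every $s\in\mathbb{C}$ (i.e. the affine Hilbert polynomial of $J$ is the constant polynomial whose value is this number).
   Context: A subset $D$ of a finite group $G$ of order $v$ is a $(v,k,\lambda)$-difference set if $|D|=k$ and for every non-identity $g\in G$ the number of pairs $(g_1,g_2)\in D\times D$ with $g_1g_2^{-1}=g$ equals $\lambda$. For $i_l\in\mathbb{Z}/n_l\mathbb{Z}$ let $i_l^*\in\{0,1,\dots,n_l-1\}$ be its representative. Let $X_1,\dots,X_t$ and $A_g$ ($g\in G$) be independent indeterminates over $\mathbb{C}$, and define $$\Psi(X,A)=\Big(\sum_{(i_1,\dots,i_t)\in G}A_{(i_1,\dots,i_t)}X_1^{i_1^*}\cdots X_t^{i_t^*}\Big)\Big(\sum_{(i_1,\dots,i_t)\in G}A_{(i_1,\dots,i_t)}X_1^{n_1-i_1^*}\cdots X_t^{n_t-i_t^*}\Big)-\lambda\sum_{(i_1,\dots,i_t)\in G}X_1^{i_1^*}\cdots X_t^{i_t^*}-(k-\lambda).$$ Let $U=\{\xi=(\xi_1,\dots,\xi_t)\in\mathbb{C}^t:\xi_l^{n_l}=1\text{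 for all }l\}$, and $\Psi(\xi,A)\in\mathbb{C}[A]$ denotes $\Psi$ with $X=\xi$ substituted. For an ideal $I$ of a polynomial ring $R=\mathbb{C}[Z_1,\dots,Z_r]$, the affine Hilbert function is ${}^aHF_I(s)=\dim_{\mathbb{C}}(R_{\le s}/(I\cap R_{\le s}))$ for integers $s\ge 0$, where $R_{\le s}$ is the space of polynomials of degree $\le s$; the affine Hilbert polynomial ${}^aHP_I$ is the polynomial agreeing with ${}^aHF_I(s)$ for all sufficiently large $s$. *)

theory Defs
  imports
    "HOL-Library.Poly_Mapping"
    "HOL-Computational_Algebra.Polynomial"
    "HOL-Algebra.Ideal"
    "HOL-Algebra.Elementary_Groups"
    "HOL-Algebra.Product_Groups"
    "Jordan_Normal_Form.VS_Connect"
begin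

section \<open>Multivariate polynomials\<close>

text \<open>A monomial is a finitely supported exponent function \<open>'v \<Rightarrow>\<^sub>0 nat\<close>. The type of
  variables may be larger than the set of variables of the polynomial ring one is interested in;
  \<open>mpoly_ring V\<close> is the ring of polynomials in the variables from \<open>V\<close> only.\<close>

type_synonym ('v, 'a) mpoly = "('v \<Rightarrow>\<^sub>0 nat) \<Rightarrow>\<^sub>0 'a"

definition mVar :: "'v \<Rightarrow> ('v, 'a::comm_ring_1) mpoly" where
  "mVar x = Poly_Mapping.single (Poly_Mapping.single x 1) 1"

definition mConst :: "'a::comm_ring_1 \<Rightarrow> ('v, 'a) mpoly" where
  "mConst c = Poly_Mapping.single 0 c"

definition mpoly_eval :: "('v \<Rightarrow> 'a::comm_ring_1) \<Rightarrow> ('v, 'a) mpoly \<Rightarrow> 'a" where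
  "mpoly_eval x p = (\<Sum>m\<in>Poly_Mapping.keys p. Poly_Mapping.lookup p m *
      (\<Prod>i\<in>Poly_Mapping.keys m. x i ^ Poly_Mapping.lookup m i))"

definition mpolys :: "'v set \<Rightarrow> ('v, 'a::comm_ring_1) mpoly set" where
  "mpolys V = {p. \<forall>m\<in>Poly_Mapping.keys p. Poly_Mapping.keys m \<subseteq> V}"

definition mpoly_ring :: "'v set \<Rightarrow> ('v, 'a::comm_ring_1) mpoly ring" where
  "mpoly_ring V = \<lparr>carrier = mpolys V, mult = (*), one = 1, zero = 0, add = (+)\<rparr>"

definition monomial_degree :: "('v \<Rightarrow>\<^sub>0 nat) \<Rightarrow> nat" where
  "monomial_degree m = (\<Sum>i\<in>Poly_Mapping.keys m. Poly_Mapping.lookup m i)"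

definition mpolys_le :: "'v set \<Rightarrow> nat \<Rightarrow> ('v, 'a::comm_ring_1) mpoly set" where
  "mpolys_le V s = {p \<in> mpolys V. \<forall>m\<in>Poly_Mapping.keys p. monomial_degree m \<le> s}"


section \<open>Affine Hilbert function and affine Hilbert polynomial\<close>

text \<open>The record type \<open>module\<close> extends the record type of rings, so it has fields for a
  multiplication and a unit; they play no role for vector spaces.\<close>

definition mpoly_space :: "'v set \<Rightarrow> nat \<Rightarrow> (complex, ('v, complex) mpoly) module" where
  "mpoly_space V s = \<lparr>carrier = mpolys_le V s, mult = undefined, one = undefined,
      zero = 0, add = (+), smult = (\<lambda>c p. mConst c * p)\<rparr>"

text \<open>The quotient of a vector space by a subspace \<open>W\<close>. The coset \<open>c \<odot> (W + x)\<close> is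
  \<open>W + (c \<odot> x)\<close>; the union below ranges over all representatives \<open>x\<close>, which
  all contribute the same coset.\<close>

definition quotient_space :: "('k, 'b, 'm) module_scheme \<Rightarrow> 'b set \<Rightarrow> ('k, 'b set) module" where
  "quotient_space M W = \<lparr>carrier = a_rcosets\<^bsub>M\<^esub> W, mult = undefined, one = undefined,
      zero = W, add = (<+>\<^bsub>M\<^esub>), smult = (\<lambda>c C. \<Union>x\<in>C. W +>\<^bsub>M\<^esub> (c \<odot>\<^bsub>M\<^esub> x))\<rparr>"

definition affine_hilbert_function :: "'v set \<Rightarrow> ('v, complex) mpoly set \<Rightarrow> nat \<Rightarrow> nat" where
  "affine_hilbert_function V I s =
     vectorspace.dim (class_ring :: complex ring)
       (quotient_space (mpoly_space V s) (I \<inter> mpolys_le V s))"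

definition affine_hilbert_poly :: "'v set \<Rightarrow> ('v, complex) mpoly set \<Rightarrow> complex poly" where
  "affine_hilbert_poly V I =
     (THE h. \<exists>s0. \<forall>s\<ge>s0. poly h (of_nat s) = of_nat (affine_hilbert_function V I s))"

lemma affine_hilbert_poly_eqI:
  assumes "\<And>s. s \<ge> s0 \<Longrightarrow> poly h (of_nat s) = of_nat (affine_hilbert_function V I s)"
  shows "affine_hilbert_poly V I = h"
  unfolding affine_hilbert_poly_def
proof (rule the_equality)
  show "\<exists>s0. \<forall>s\<ge>s0. poly h (of_nat s) = of_nat (affine_hilbert_function V I s)"
    using assms by blast
next
  fix h' :: "complex poly"
  assume "\<exists>s0. \<forall>s\<ge>s0. poly h' (of_nat s) = of_nat (affine_hilbert_function V I s)"
  then obtain s1 where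
    s1: "\<And>s. s \<ge> s1 \<Longrightarrow> poly h' (of_nat s) = of_nat (affine_hilbert_function V I s)"
    by blast
  have "of_nat ` {max s0 s1..} \<subseteq> {x. poly (h' - h) x = 0}"
    using assms s1 by auto
  moreover have "infinite ((of_nat :: nat \<Rightarrow> complex) ` {max s0 s1..})"
    by (simp add: finite_image_iff inj_on_def infinite_Ici)
  ultimately have "infinite {x. poly (h' - h) x = 0}"
    using finite_subset by blast
  then show "h' = h"
    using poly_roots_finite[of "h' - h"] by auto
qed


section \<open>Difference sets and the polynomials attached to them\<close>

definition difference_set :: "('a, 'b) monoid_scheme \<Rightarrow> nat \<Rightarrow> int \<Rightarrow> int \<Rightarrow> 'a set \<Rightarrow> bool" where
  "difference_set G v k lam D \<longleftrightarrow>
     Coset.order G = v \<and> D \<subseteq> carrier G \<and> int (card D) = k \<and>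
     (\<forall>g\<in>carrier G - {\<one>\<^bsub>G\<^esub>}.
        int (card {(g1, g2). g1 \<in> D \<and> g2 \<in> D \<and> g1 \<otimes>\<^bsub>G\<^esub> inv\<^bsub>G\<^esub> g2 = g}) = lam)"

text \<open>For \<open>n l > 0\<close> the carrier of \<open>integer_mod_group (n l)\<close> is \<open>{0..<int (n l)}\<close>, so
  that an element \<open>i\<close> of the product group already consists of the standard
  representatives \<open>i l\<close>, and \<open>nat (i l)\<close> is the exponent written with a star on paper.\<close>

definition cyclic_product :: "nat \<Rightarrow> (nat \<Rightarrow> nat) \<Rightarrow> (nat \<Rightarrow> int) monoid" where
  "cyclic_product t n = product_group {1..t} (\<lambda>l. integer_mod_group (n l))"

text \<open>The ring of polynomials over the complex numbers in the independent indeterminates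
  \<open>X\<^sub>1, \<dots>, X\<^sub>t\<close> and \<open>A\<^sub>g\<close> is represented as the ring of polynomials in the \<open>X\<^sub>l\<close> whose
  coefficients are polynomials in the \<open>A\<^sub>g\<close>.\<close>

definition Psi :: "nat \<Rightarrow> (nat \<Rightarrow> nat) \<Rightarrow> int \<Rightarrow> int \<Rightarrow> (nat, (nat \<Rightarrow> int, complex) mpoly) mpoly" where
  "Psi t n k lam =
     (\<Sum>i\<in>carrier (cyclic_product t n). mConst (mVar i) * (\<Prod>l=1..t. mVar l ^ nat (i l))) *
     (\<Sum>i\<in>carrier (cyclic_product t n). mConst (mVar i) * (\<Prod>l=1..t. mVar l ^ (n l - nat (i l)))) -
     of_int lam * (\<Sum>i\<in>carrier (cyclic_product t n). \<Prod>l=1..t. mVar l ^ nat (i l)) -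
     of_int (k - lam)"

definition Psi_at ::
    "nat \<Rightarrow> (nat \<Rightarrow> nat) \<Rightarrow> int \<Rightarrow> int \<Rightarrow> (nat \<Rightarrow> complex) \<Rightarrow> (nat \<Rightarrow> int, complex) mpoly" where
  "Psi_at t n k lam \<xi> = mpoly_eval (\<lambda>l. mConst (\<xi> l)) (Psi t n k lam)"

definition root_tuples :: "nat \<Rightarrow> (nat \<Rightarrow> nat) \<Rightarrow> (nat \<Rightarrow> complex) set" where
  "root_tuples t n = {\<xi> \<in> {1..t} \<rightarrow>\<^sub>E UNIV. \<forall>l\<in>{1..t}. \<xi> l ^ n l = 1}"

definition difference_set_ideal ::
    "nat \<Rightarrow> (nat \<Rightarrow> nat) \<Rightarrow> int \<Rightarrow> int \<Rightarrow> (nat \<Rightarrow> int, complex) mpoly set" where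
  "difference_set_ideal t n k lam =
     Idl\<^bsub>mpoly_ring (carrier (cyclic_product t n))\<^esub>
       (Psi_at t n k lam ` root_tuples t n \<union>
        (\<lambda>g. mVar g ^ 2 - mVar g) ` carrier (cyclic_product t n))"

end

theory Submission
  imports Defs
begin

text \<open>The polynomials \<open>A\<^sub>g\<^sup>2 - A\<^sub>g\<close> force every zero of the ideal to be the indicator of a subset
  \<open>D\<close> of the group. Evaluated there, \<open>\<Psi>(\<xi>, A)\<close> is the value at the character \<open>\<xi>\<close> of
  \<open>D D\<^sup>-\<^sup>1 - \<lambda> G - (k - \<lambda>)\<close> in the group ring, so by orthogonality of characters it vanishes for
  all \<open>\<xi>\<close> iff \<open>D\<close> is a difference set. Modulo the polynomials \<open>A\<^sub>g\<^sup>2 - A\<^sub>g\<close> the Lagrange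
  polynomials of the indicator points are orthogonal idempotents with sum \<open>1\<close>; hence the ideal
  consists of all polynomials that vanish at the difference sets. As the Lagrange polynomials have
  degree \<open>v\<close>, evaluation at the difference sets is surjective on the polynomials of degree
  at most \<open>s\<close> whenever \<open>s \<ge> v\<close>.\<close>

section \<open>Evaluation of polynomials\<close>

definition monomial_eval :: "('v \<Rightarrow> 'a::comm_ring_1) \<Rightarrow> ('v \<Rightarrow>\<^sub>0 nat) \<Rightarrow> 'a" where
  "monomial_eval x m = (\<Prod>i\<in>Poly_Mapping.keys m. x i ^ Poly_Mapping.lookup m i)"

lemma poly_mapping_eq_sum_single:
  fixes p :: "'b \<Rightarrow>\<^sub>0 'a::comm_monoid_add"
  shows "p = (\<Sum>m\<in>Poly_Mapping.keys p. Poly_Mapping.single m (Poly_Mapping.lookup p m))"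
  by (rule poly_mapping_eqI)
    (simp add: lookup_sum lookup_single when_def in_keys_iff)

text \<open>Enlarging the index set only adds exponents zero, hence factors 1. This puts monomials
  with different keys over one common index set.\<close>

lemma monomial_eval_superset:
  assumes "finite S" "Poly_Mapping.keys m \<subseteq> S"
  shows "monomial_eval x m = (\<Prod>i\<in>S. x i ^ Poly_Mapping.lookup m i)"
  unfolding monomial_eval_def
  using assms by (intro prod.mono_neutral_left) (auto simp: in_keys_iff)

lemma monomial_eval_zero [simp]: "monomial_eval x 0 = 1"
  by (simp add: monomial_eval_def)

lemma monomial_eval_single [simp]: "monomial_eval x (Poly_Mapping.single i k) = x i ^ k"
  by (simp add: monomial_eval_def)

lemma monomial_eval_add: "monomial_eval x (m + m') = monomial_eval x m * monomial_eval x m'"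
proof -
  let ?S = "Poly_Mapping.keys m \<union> Poly_Mapping.keys m'"
  have "monomial_eval x (m + m') = (\<Prod>i\<in>?S. x i ^ Poly_Mapping.lookup (m + m') i)"
    by (intro monomial_eval_superset keys_add) auto
  moreover have "monomial_eval x m = (\<Prod>i\<in>?S. x i ^ Poly_Mapping.lookup m i)"
    by (intro monomial_eval_superset) auto
  moreover have "monomial_eval x m' = (\<Prod>i\<in>?S. x i ^ Poly_Mapping.lookup m' i)"
    by (intro monomial_eval_superset) auto
  ultimately show ?thesis
    by (simp add: lookup_add power_add prod.distrib)
qed

text \<open>Cancellation can make the keys of a sum smaller than the union of the keys of its
  summands; summing over a superset adds only zero coefficients.\<close>

lemma mpoly_eval_superset:
  assumes "finite S" "Poly_Mapping.keys p \<subseteq> S"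
  shows "mpoly_eval x p = (\<Sum>m\<in>S. Poly_Mapping.lookup p m * monomial_eval x m)"
  unfolding mpoly_eval_def monomial_eval_def
  using assms by (intro sum.mono_neutral_left) (auto simp: in_keys_iff)

lemma mpoly_eval_zero [simp]: "mpoly_eval x 0 = 0"
  by (simp add: mpoly_eval_def)

lemma mpoly_eval_single [simp]:
  "mpoly_eval x (Poly_Mapping.single m c) = c * monomial_eval x m"
  by (simp add: mpoly_eval_def monomial_eval_def)

lemma mpoly_eval_add [simp]: "mpoly_eval x (p + q) = mpoly_eval x p + mpoly_eval x q"
proof -
  let ?S = "Poly_Mapping.keys p \<union> Poly_Mapping.keys q"
  have "mpoly_eval x (p + q) = (\<Sum>m\<in>?S. Poly_Mapping.lookup (p + q) m * monomial_eval x m)"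
    by (intro mpoly_eval_superset keys_add) auto
  moreover have "mpoly_eval x p = (\<Sum>m\<in>?S. Poly_Mapping.lookup p m * monomial_eval x m)"
    by (intro mpoly_eval_superset) auto
  moreover have "mpoly_eval x q = (\<Sum>m\<in>?S. Poly_Mapping.lookup q m * monomial_eval x m)"
    by (intro mpoly_eval_superset) auto
  ultimately show ?thesis
    by (simp add: lookup_add distrib_right sum.distrib)
qed

lemma mpoly_eval_diff [simp]: "mpoly_eval x (p - q) = mpoly_eval x p - mpoly_eval x q"
  using mpoly_eval_add[of x "p - q" q] by (simp add: algebra_simps)

lemma mpoly_eval_sum [simp]: "mpoly_eval x (\<Sum>i\<in>I. f i) = (\<Sum>i\<in>I. mpoly_eval x (f i))"
  by (induction I rule: infinite_finite_induct) auto

lemma mpoly_eval_mult [simp]: "mpoly_eval x (p * q) = mpoly_eval x p * mpoly_eval x q"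
proof -
  \<comment> \<open>The product is kept as an uncollected double sum of single terms, so the keys of
    \<open>p * q\<close>, where coefficients may cancel, never have to be determined.\<close>
  have "p * q = (\<Sum>m\<in>Poly_Mapping.keys p. \<Sum>m'\<in>Poly_Mapping.keys q. Poly_Mapping.single (m + m')
      (Poly_Mapping.lookup p m * Poly_Mapping.lookup q m'))"
    by (subst poly_mapping_eq_sum_single[of p], subst poly_mapping_eq_sum_single[of q])
      (simp add: sum_product mult_single)
  then show ?thesis
    by (simp add: monomial_eval_add mpoly_eval_superset[OF _ order_refl] sum_product mult_ac)
qed

lemma mpoly_eval_mConst [simp]: "mpoly_eval x (mConst c) = c"
  by (simp add: mConst_def)

lemma mpoly_eval_mVar [simp]: "mpoly_eval x (mVar i) = x i"
  by (simp add: mVar_def)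

lemma mpoly_eval_one [simp]: "mpoly_eval x 1 = 1"
  by (metis mpoly_eval_mConst mConst_def single_one)

lemma mpoly_eval_of_int [simp]: "mpoly_eval x (of_int c) = of_int c"
  by (metis mpoly_eval_mConst mConst_def single_of_int)

lemma mpoly_eval_power [simp]: "mpoly_eval x (p ^ k) = mpoly_eval x p ^ k"
  by (induction k) auto

lemma mpoly_eval_prod [simp]: "mpoly_eval x (\<Prod>i\<in>I. f i) = (\<Prod>i\<in>I. mpoly_eval x (f i))"
  by (induction I rule: infinite_finite_induct) auto


section \<open>Polynomials in a given set of variables\<close>

lemma mpolys_le_subset: "mpolys_le V s \<subseteq> mpolys V"
  by (auto simp: mpolys_le_def)

lemma mpolys_le_mono: "s \<le> s' \<Longrightarrow> mpolys_le V s \<subseteq> mpolys_le V s'"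
  by (auto simp: mpolys_le_def)

lemma mConst_in_mpolys_le [simp]: "mConst c \<in> mpolys_le V s"
  by (auto simp: mpolys_le_def mpolys_def mConst_def monomial_degree_def)

lemma mVar_in_mpolys_le [simp]: "i \<in> V \<Longrightarrow> 1 \<le> s \<Longrightarrow> mVar i \<in> mpolys_le V s"
  by (auto simp: mpolys_le_def mpolys_def mVar_def monomial_degree_def)

lemma zero_in_mpolys_le [simp]: "0 \<in> mpolys_le V s"
  by (auto simp: mpolys_le_def mpolys_def)

lemma mpolys_le_add:
  assumes "p \<in> mpolys_le V s" "q \<in> mpolys_le V s"
  shows "p + q \<in> mpolys_le V s"
  using assms keys_add[of p q] unfolding mpolys_le_def mpolys_def by blast

lemma monomial_degree_add: "monomial_degree (m + m') = monomial_degree m + monomial_degree m'"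
proof -
  let ?S = "Poly_Mapping.keys m \<union> Poly_Mapping.keys m'"
  have "monomial_degree (m + m') = (\<Sum>i\<in>?S. Poly_Mapping.lookup (m + m') i)"
    unfolding monomial_degree_def using keys_add[of m m']
    by (intro sum.mono_neutral_left) (auto simp: in_keys_iff)
  moreover have "monomial_degree m = (\<Sum>i\<in>?S. Poly_Mapping.lookup m i)"
    unfolding monomial_degree_def by (intro sum.mono_neutral_left) (auto simp: in_keys_iff)
  moreover have "monomial_degree m' = (\<Sum>i\<in>?S. Poly_Mapping.lookup m' i)"
    unfolding monomial_degree_def by (intro sum.mono_neutral_left) (auto simp: in_keys_iff)
  ultimately show ?thesis
    by (simp add: lookup_add sum.distrib)
qed

lemma mpolys_mult:
  assumes "p \<in> mpolys V" "q \<in> mpolys V"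
  shows "p * q \<in> mpolys V"
proof -
  have "Poly_Mapping.keys m \<subseteq> V" if m: "m \<in> Poly_Mapping.keys (p * q)" for m
  proof -
    obtain a b where "m = a + b" "a \<in> Poly_Mapping.keys p" "b \<in> Poly_Mapping.keys q"
      using subsetD[OF keys_mult m] by auto
    then show ?thesis
      using assms keys_add[of a b] by (fastforce simp: mpolys_def)
  qed
  then show ?thesis by (auto simp: mpolys_def)
qed

lemma mpolys_le_mult:
  assumes "p \<in> mpolys_le V r" "q \<in> mpolys_le V s"
  shows "p * q \<in> mpolys_le V (r + s)"
proof -
  have "monomial_degree m \<le> r + s" if m: "m \<in> Poly_Mapping.keys (p * q)" for m
  proof -
    obtain a b where "m = a + b" "a \<in> Poly_Mapping.keys p" "b \<in> Poly_Mapping.keys q"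
      using subsetD[OF keys_mult m] by auto
    then show ?thesis
      using assms by (auto simp: mpolys_le_def monomial_degree_add intro!: add_mono)
  qed
  moreover have "p * q \<in> mpolys V"
    using assms by (intro mpolys_mult) (auto simp: mpolys_le_def)
  ultimately show ?thesis by (auto simp: mpolys_le_def)
qed

lemma mpolys_le_sum:
  "(\<And>i. i \<in> I \<Longrightarrow> f i \<in> mpolys_le V s) \<Longrightarrow> (\<Sum>i\<in>I. f i) \<in> mpolys_le V s"
  by (induction I rule: infinite_finite_induct) (auto intro: mpolys_le_add)

lemma mpolys_le_prod:
  "(\<And>i. i \<in> I \<Longrightarrow> f i \<in> mpolys_le V 1) \<Longrightarrow> finite I \<Longrightarrow> (\<Prod>i\<in>I. f i) \<in> mpolys_le V (card I)"
proof (induction I rule: infinite_finite_induct)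
  case empty
  show ?case using mConst_in_mpolys_le[of 1] by (simp add: mConst_def)
next
  case (insert i I)
  then show ?case using mpolys_le_mult[of "f i" V 1 "prod f I" "card I"] by simp
qed simp

lemma mConst_in_mpolys [simp]: "mConst c \<in> mpolys V"
  using mConst_in_mpolys_le mpolys_le_subset by blast

lemma mVar_in_mpolys [simp]: "i \<in> V \<Longrightarrow> mVar i \<in> mpolys V"
  by (auto simp: mpolys_def mVar_def)

lemma zero_in_mpolys [simp]: "0 \<in> mpolys V"
  by (auto simp: mpolys_def)

lemma of_int_in_mpolys [simp]: "of_int c \<in> mpolys V"
  by (metis mConst_in_mpolys mConst_def single_of_int)

lemma one_in_mpolys [simp]: "1 \<in> mpolys V"
  using of_int_in_mpolys[of 1] by simp

lemma mpolys_add: "p \<in> mpolys V \<Longrightarrow> q \<in> mpolys V \<Longrightarrow> p + q \<in> mpolys V"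
  using keys_add[of p q] unfolding mpolys_def by blast

lemma mpolys_uminus: "p \<in> mpolys V \<Longrightarrow> - p \<in> mpolys V"
  using mpolys_mult[OF of_int_in_mpolys[of "-1"], of p] by simp

lemma mpolys_diff: "p \<in> mpolys V \<Longrightarrow> q \<in> mpolys V \<Longrightarrow> p - q \<in> mpolys V"
  using mpolys_add[OF _ mpolys_uminus] by fastforce

lemma mpolys_sum: "(\<And>i. i \<in> I \<Longrightarrow> f i \<in> mpolys V) \<Longrightarrow> (\<Sum>i\<in>I. f i) \<in> mpolys V"
  by (induction I rule: infinite_finite_induct) (auto intro: mpolys_add)

lemma mpolys_prod: "(\<And>i. i \<in> I \<Longrightarrow> f i \<in> mpolys V) \<Longrightarrow> (\<Prod>i\<in>I. f i) \<in> mpolys V"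
  by (induction I rule: infinite_finite_induct) (auto intro: mpolys_mult)

lemma mpolys_power: "p \<in> mpolys V \<Longrightarrow> p ^ k \<in> mpolys V"
  by (induction k) (auto intro: mpolys_mult)

lemma single_eq_prod_mVar:
  fixes c :: "'a::comm_ring_1" and m :: "'v \<Rightarrow>\<^sub>0 nat"
  shows "Poly_Mapping.single m c =
    mConst c * (\<Prod>i\<in>Poly_Mapping.keys m. mVar i ^ Poly_Mapping.lookup m i)"
proof -
  have power: "mVar i ^ k = Poly_Mapping.single (Poly_Mapping.single i k) (1::'a)" for i :: 'v and k
    by (induction k) (simp_all add: mVar_def mult_single flip: single_add)
  have prod: "(\<Prod>i\<in>I. Poly_Mapping.single (f i) (1::'a)) = Poly_Mapping.single (\<Sum>i\<in>I. f i) 1"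
    for I :: "'v set" and f :: "'v \<Rightarrow> 'v \<Rightarrow>\<^sub>0 nat"
    by (induction I rule: infinite_finite_induct) (auto simp: mult_single)
  show ?thesis
    by (simp add: power prod mConst_def mult_single flip: poly_mapping_eq_sum_single)
qed

text \<open>Each term of a polynomial is a constant times a product of powers of its variables, so
  constants and variables generate everything under sums and products.\<close>

lemma mpolys_induct [consumes 1, case_names const var add mult]:
  assumes "p \<in> mpolys V"
    and const: "\<And>c. P (mConst c)"
    and var: "\<And>i. i \<in> V \<Longrightarrow> P (mVar i)"
    and add: "\<And>p q. p \<in> mpolys V \<Longrightarrow> q \<in> mpolys V \<Longrightarrow> P p \<Longrightarrow> P q \<Longrightarrow> P (p + q)"
    and mult: "\<And>p q. p \<in> mpolys V \<Longrightarrow> q \<in> mpolys V \<Longrightarrow> P p \<Longrightarrow> P q \<Longrightarrow> P (p * q)"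
  shows "P p"
proof -
  \<comment> \<open>Membership is carried along because the hypotheses \<open>add\<close> and
    \<open>mult\<close> speak only of polynomials in \<open>mpolys V\<close>.\<close>
  define Q where "Q p \<longleftrightarrow> p \<in> mpolys V \<and> P p" for p
  have one: "Q 1"
    using const[of 1] by (simp add: Q_def mConst_def)
  have zero: "Q 0"
    using const[of 0] by (simp add: Q_def mConst_def)
  have Q_mult: "Q (p * q)" if "Q p" "Q q" for p q
    using that mult by (auto simp: Q_def mpolys_mult)
  have Q_power: "Q (p ^ k)" if "Q p" for p k
    by (induction k) (use one that Q_mult in auto)
  have Q_prod: "Q (\<Prod>i\<in>I. f i)" if "\<And>i. i \<in> I \<Longrightarrow> Q (f i)" for I :: "'a set" and f
    using that by (induction I rule: infinite_finite_induct) (use one Q_mult in auto)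
  have Q_sum: "Q (\<Sum>i\<in>I. f i)" if "\<And>i. i \<in> I \<Longrightarrow> Q (f i)" for I :: "('a \<Rightarrow>\<^sub>0 nat) set" and f
    using that by (induction I rule: infinite_finite_induct)
      (use zero add in \<open>auto simp: Q_def mpolys_add\<close>)
  have "Q (Poly_Mapping.single m (Poly_Mapping.lookup p m))" if "m \<in> Poly_Mapping.keys p" for m
  proof -
    have "Poly_Mapping.keys m \<subseteq> V"
      using assms(1) that by (auto simp: mpolys_def)
    then show ?thesis
      unfolding single_eq_prod_mVar
      by (intro Q_mult Q_prod Q_power) (use const var in \<open>auto simp: Q_def\<close>)
  qed
  then have "Q p"
    by (subst poly_mapping_eq_sum_single) (rule Q_sum)
  then show ?thesis by (simp add: Q_def)
qed

section \<open>The ring of polynomials in given variables and its ideals\<close>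

lemma mpoly_ring_cring: "cring (mpoly_ring V)"
proof (rule cringI)
  show "abelian_group (mpoly_ring V)"
  proof (rule abelian_groupI)
    fix x assume "x \<in> carrier (mpoly_ring V)"
    then show "\<exists>y\<in>carrier (mpoly_ring V). y \<oplus>\<^bsub>mpoly_ring V\<^esub> x = \<zero>\<^bsub>mpoly_ring V\<^esub>"
      by (intro bexI[of _ "- x"]) (auto simp: mpoly_ring_def mpolys_uminus)
  qed (auto simp: mpoly_ring_def mpolys_add algebra_simps)
  show "Group.comm_monoid (mpoly_ring V)"
    by (rule comm_monoidI) (auto simp: mpoly_ring_def mpolys_mult mult_ac)
qed (auto simp: mpoly_ring_def algebra_simps)

text \<open>Transfers the ideal laws from the record operations to the type class operations on
  polynomials, in which the later computations are done.\<close>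

lemma mpoly_ring_ideal:
  assumes "ideal J (mpoly_ring V)"
  shows mpoly_ideal_zero: "0 \<in> J"
    and mpoly_ideal_add: "p \<in> J \<Longrightarrow> q \<in> J \<Longrightarrow> p + q \<in> J"
    and mpoly_ideal_mult: "r \<in> mpolys V \<Longrightarrow> p \<in> J \<Longrightarrow> r * p \<in> J"
    and mpoly_ideal_diff: "p \<in> J \<Longrightarrow> q \<in> J \<Longrightarrow> p - q \<in> J"
    and mpoly_ideal_sum: "(\<And>i. i \<in> I \<Longrightarrow> f i \<in> J) \<Longrightarrow> (\<Sum>i\<in>I. f i) \<in> J"
proof -
  interpret ideal J "mpoly_ring V" by fact
  show zero: "0 \<in> J"
    using additive_subgroup.zero_closed[OF is_additive_subgroup] by (simp add: mpoly_ring_def)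
  show add: "p + q \<in> J" if "p \<in> J" "q \<in> J" for p q
    using additive_subgroup.a_closed[OF is_additive_subgroup that] by (simp add: mpoly_ring_def)
  show mult: "r * p \<in> J" if "r \<in> mpolys V" "p \<in> J" for r p
    using I_l_closed[of p r] that by (simp add: mpoly_ring_def)
  show "p - q \<in> J" if "p \<in> J" "q \<in> J" for p q
    using add[OF that(1) mult[OF of_int_in_mpolys[of "-1"] that(2)]] by simp
  show "(\<Sum>i\<in>I. f i) \<in> J" if "\<And>i. i \<in> I \<Longrightarrow> f i \<in> J"
    using that by (induction I rule: infinite_finite_induct) (auto simp: zero add)
qed

section \<open>Ideals containing the Boolean polynomials\<close>

abbreviation boolean_point :: "'v set \<Rightarrow> 'v \<Rightarrow> 'a::comm_ring_1" where
  "boolean_point D \<equiv> (\<lambda>g. of_bool (g \<in> D))"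

text \<open>The interpolation polynomial on the cube of 0-1 points that singles out the indicator of
  \<open>D\<close>.\<close>

definition lagrange_poly :: "'v set \<Rightarrow> 'v set \<Rightarrow> ('v, 'a::comm_ring_1) mpoly" where
  "lagrange_poly V D = (\<Prod>g\<in>D. mVar g) * (\<Prod>g\<in>V - D. 1 - mVar g)"

text \<open>There is one factor of degree at most 1 for each element of \<open>V\<close>. The bound
  \<open>card V\<close> is later the threshold from which the Hilbert function is constant.\<close>

lemma lagrange_poly_in_mpolys_le:
  assumes "finite V" "D \<subseteq> V"
  shows "lagrange_poly V D \<in> mpolys_le V (card V)"
proof -
  have "finite D" using assms finite_subset by blast
  have 1: "1 - mVar g \<in> mpolys_le V 1" if "g \<in> V" for g
  proof -
    \<comment> \<open>The difference is written with sums and products, for which the degree bounds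
      are available.\<close>
    have "mConst 1 + mConst (-1) * mVar g \<in> mpolys_le V 1"
      using that mpolys_le_mult[of "mConst (-1)" V 0 "mVar g" 1] by (intro mpolys_le_add) auto
    then show ?thesis
      by (simp add: mConst_def single_uminus)
  qed
  have "lagrange_poly V D \<in> mpolys_le V (card D + card (V - D))"
    unfolding lagrange_poly_def
    using assms \<open>finite D\<close> by (intro mpolys_le_mult mpolys_le_prod 1) auto
  then show ?thesis
    using assms \<open>finite D\<close> by (simp add: card_Diff_subset card_mono)
qed

lemma lagrange_poly_in_mpolys:
  "finite V \<Longrightarrow> D \<subseteq> V \<Longrightarrow> lagrange_poly V D \<in> mpolys V"
  using lagrange_poly_in_mpolys_le mpolys_le_subset by blast

lemma eval_lagrange_poly:
  assumes "finite V" "D \<subseteq> V" "E \<subseteq> V"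
  shows "mpoly_eval (boolean_point E) (lagrange_poly V D) = of_bool (E = D)"
proof (cases "E = D")
  case True
  then show ?thesis by (simp add: lagrange_poly_def)
next
  case False
  have "finite D" using assms finite_subset by blast
  \<comment> \<open>An element of the symmetric difference of \<open>D\<close> and \<open>E\<close>
    makes one factor vanish: in the first product if it lies in \<open>D\<close>, in the second if
    it lies in \<open>E\<close>.\<close>
  consider g where "g \<in> D" "g \<notin> E" | g where "g \<in> V - D" "g \<in> E"
    using False assms by blast
  then have "(\<Prod>g\<in>D. boolean_point E g) * (\<Prod>g\<in>V - D. 1 - boolean_point E g) = (0::'b)"
  proof cases
    case 1
    then have "(\<Prod>g\<in>D. boolean_point E g) = (0::'b)"
      using \<open>finite D\<close> by (intro prod_zero bexI[of _ g]) auto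
    then show ?thesis by simp
  next
    case 2
    then have "(\<Prod>g\<in>V - D. 1 - boolean_point E g) = (0::'b)"
      using assms by (intro prod_zero bexI[of _ g]) auto
    then show ?thesis by simp
  qed
  then show ?thesis
    using False by (simp add: lagrange_poly_def)
qed

text \<open>Expand the product over \<open>V\<close> of the factors
  \<open>mVar g + (1 - mVar g)\<close>, each of which is 1: choosing a summand in every factor
  amounts to choosing \<open>D\<close>.\<close>

lemma sum_lagrange_poly:
  assumes "finite V"
  shows "(\<Sum>D\<in>Pow V. lagrange_poly V D) = 1"
  unfolding lagrange_poly_def by (subst prod_add[OF assms, symmetric]) simp

text \<open>Modulo \<open>J\<close>, the Lagrange polynomial of \<open>D\<close> is an eigenvector
  of multiplication by \<open>p\<close>, with the value of \<open>p\<close> at \<open>D\<close> as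
  eigenvalue. In the induction on \<open>p\<close> only the variables need the Boolean
  polynomials.\<close>

lemma mult_lagrange_poly_cong:
  fixes p :: "('v, 'a::comm_ring_1) mpoly"
  assumes "finite V" "ideal J (mpoly_ring V)"
    and bool: "\<And>g. g \<in> V \<Longrightarrow> mVar g ^ 2 - mVar g \<in> J"
    and "D \<subseteq> V" "p \<in> mpolys V"
  shows "p * lagrange_poly V D - mConst (mpoly_eval (boolean_point D) p) * lagrange_poly V D \<in> J"
  using \<open>p \<in> mpolys V\<close>
proof (induction rule: mpolys_induct)
  case (const c)
  show ?case using mpoly_ideal_zero[OF assms(2)] by simp
next
  case (var g)
  have "finite D" using assms finite_subset by blast
  show ?case
  proof (cases "g \<in> D")
    case True
    \<comment> \<open>The cofactor of \<open>mVar g\<close> in the Lagrange polynomial; the value of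
      \<open>mVar g\<close> at \<open>D\<close> is 1, so the difference is
      \<open>r * (mVar g ^ 2 - mVar g)\<close>.\<close>
    define r :: "('v, 'a) mpoly" where "r = (\<Prod>g\<in>D - {g}. mVar g) * (\<Prod>g\<in>V - D. 1 - mVar g)"
    have "r \<in> mpolys V"
      unfolding r_def using assms by (intro mpolys_mult mpolys_prod mpolys_diff) auto
    moreover have "lagrange_poly V D = mVar g * r"
      unfolding lagrange_poly_def r_def using True \<open>finite D\<close>
      by (simp add: prod.remove mult_ac)
    ultimately show ?thesis
      using mpoly_ideal_mult[OF assms(2) _ bool[OF var], of r] True
      by (simp add: mConst_def algebra_simps power2_eq_square)
  next
    case False
    \<comment> \<open>Now the value of \<open>mVar g\<close> at \<open>D\<close> is 0, and
      \<open>r\<close> is the cofactor of \<open>1 - mVar g\<close>; multiplying by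
      \<open>mVar g\<close> again produces the Boolean polynomial, up to sign.\<close>
    define r :: "('v, 'a) mpoly" where "r = (\<Prod>g\<in>D. mVar g) * (\<Prod>g\<in>V - D - {g}. 1 - mVar g)"
    have "r \<in> mpolys V"
      unfolding r_def using assms by (intro mpolys_mult mpolys_prod mpolys_diff) auto
    moreover have "lagrange_poly V D = (1 - mVar g) * r"
      unfolding lagrange_poly_def r_def using False assms(1) var
      by (simp add: prod.remove[of "V - D" g] mult_ac)
    moreover have "mVar g * ((1 - mVar g) * r) = - r * (mVar g ^ 2 - mVar g)"
      by (simp add: algebra_simps power2_eq_square)
    ultimately show ?thesis
      using mpoly_ideal_mult[OF assms(2) _ bool[OF var], of "- r"] False
      by (simp add: mConst_def mpolys_uminus)
  qed
next
  case (add p q)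
  then show ?case
    using mpoly_ideal_add[OF assms(2) add.IH] by (simp add: mConst_def single_add algebra_simps)
next
  case (mult p q)
  let ?L = "lagrange_poly V D" and ?p = "mConst (mpoly_eval (boolean_point D) p)"
    and ?q = "mConst (mpoly_eval (boolean_point D) q)"
  \<comment> \<open>The two induction hypotheses are combined so that the mixed terms
    \<open>p * ?q * ?L\<close> cancel.\<close>
  have "p * (q * ?L - ?q * ?L) + ?q * (p * ?L - ?p * ?L) \<in> J"
    using mult by (intro mpoly_ideal_add[OF assms(2)] mpoly_ideal_mult[OF assms(2)]) auto
  moreover have "mConst (mpoly_eval (boolean_point D) (p * q)) = ?q * ?p"
    by (simp add: mConst_def mult_single mult.commute)
  moreover have "p * (q * ?L - ?q * ?L) + ?q * (p * ?L - ?p * ?L) = p * q * ?L - ?q * ?p * ?L"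
    by (simp add: algebra_simps)
  ultimately show ?case
    by metis
qed

section \<open>Vanishing ideals of sets of indicator points\<close>

lemma ideal_vanishing: "ideal {p \<in> mpolys V. \<forall>x\<in>Z. mpoly_eval x p = 0} (mpoly_ring V)"
  (is "ideal ?I _")
proof -
  interpret cring "mpoly_ring V" by (rule mpoly_ring_cring)
  have uminus: "\<ominus>\<^bsub>mpoly_ring V\<^esub> p = - p" if "p \<in> mpolys V" for p
    using that by (intro minus_equality) (auto simp: mpoly_ring_def mpolys_uminus)
  show ?thesis
  proof (rule idealI)
    show "ring (mpoly_ring V)" ..
    show "subgroup ?I (add_monoid (mpoly_ring V))"
    proof (rule add.subgroupI)
      show "\<ominus>\<^bsub>mpoly_ring V\<^esub> p \<in> ?I" if "p \<in> ?I" for p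
        using that mpolys_uminus mpoly_eval_diff[of _ 0 p] by (auto simp: uminus)
    qed (auto simp: mpoly_ring_def mpolys_add intro!: exI[of _ 0])
  qed (auto simp: mpoly_ring_def mpolys_mult)
qed

text \<open>A Nullstellensatz over any field, without passing to a radical: the Boolean generators
  confine the zeros to the cube and let any polynomial be split into its parts
  \<open>p * lagrange_poly V D\<close>, which are treated one \<open>D\<close> at a time.\<close>

theorem genideal_boolean:
  fixes F :: "('v, 'a::field) mpoly set"
  assumes "finite V" "F \<subseteq> mpolys V"
  defines "Z \<equiv> {D \<in> Pow V. \<forall>f\<in>F. mpoly_eval (boolean_point D) f = 0}"
  shows "Idl\<^bsub>mpoly_ring V\<^esub> (F \<union> (\<lambda>g. mVar g ^ 2 - mVar g) ` V) =
    {p \<in> mpolys V. \<forall>x\<in>boolean_point ` Z. mpoly_eval x p = 0}"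
    (is "Idl\<^bsub>_\<^esub> ?S = ?I")
proof (rule equalityI)
  interpret cring "mpoly_ring V" by (rule mpoly_ring_cring)
  have S: "?S \<subseteq> carrier (mpoly_ring V)"
    using assms(2) by (auto simp: mpoly_ring_def intro!: mpolys_diff mpolys_power)
  have "?S \<subseteq> ?I"
    using S by (auto simp: mpoly_ring_def Z_def)
  then show "Idl\<^bsub>mpoly_ring V\<^esub> ?S \<subseteq> ?I"
    by (rule genideal_minimal[OF ideal_vanishing])
  define J where "J = Idl\<^bsub>mpoly_ring V\<^esub> ?S"
  have J: "ideal J (mpoly_ring V)"
    unfolding J_def by (rule genideal_ideal[OF S])
  have "?S \<subseteq> J"
    unfolding J_def by (rule genideal_self[OF S])
  then have F: "F \<subseteq> J" and bool: "\<And>g. g \<in> V \<Longrightarrow> mVar g ^ 2 - mVar g \<in> J"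
    by auto
  have cong: "p * lagrange_poly V D - mConst (mpoly_eval (boolean_point D) p) * lagrange_poly V D \<in> J"
    if "p \<in> mpolys V" "D \<subseteq> V" for p D
    using that by (intro mult_lagrange_poly_cong[OF assms(1) J bool])
  show "?I \<subseteq> J"
  proof
    fix p assume p: "p \<in> ?I"
    \<comment> \<open>At a zero \<open>D\<close> the value of \<open>p\<close> is 0, so the
      congruence itself says that the product is in \<open>J\<close>. At any other \<open>D\<close>
      the Lagrange polynomial is, up to a unit, in \<open>J\<close>.\<close>
    have "p * lagrange_poly V D \<in> J" if D: "D \<subseteq> V" for D
    proof (cases "D \<in> Z")
      case True
      then show ?thesis
        using cong[of p D] p D by (auto simp: mConst_def)
    next
      case False
      then obtain f where f: "f \<in> F" "mpoly_eval (boolean_point D) f \<noteq> 0"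
        using D by (auto simp: Z_def)
      let ?c = "mpoly_eval (boolean_point D) f"
      have "f \<in> mpolys V" "f \<in> J"
        using f F assms(2) by auto
      then have "f * lagrange_poly V D \<in> J"
        using mpoly_ideal_mult[OF J lagrange_poly_in_mpolys[OF assms(1) D], of f]
        by (simp add: mult.commute)
      \<comment> \<open>Both \<open>f * lagrange_poly V D\<close> and its difference from
        \<open>?c\<close> times the Lagrange polynomial are in \<open>J\<close>; the nonzero scalar
        \<open>?c\<close> is then inverted.\<close>
      from mpoly_ideal_diff[OF J this cong[OF \<open>f \<in> mpolys V\<close> D]]
      have "mConst ?c * lagrange_poly V D \<in> J" by simp
      then have "(p * mConst (1 / ?c)) * (mConst ?c * lagrange_poly V D) \<in> J"
        using p by (intro mpoly_ideal_mult[OF J _ \<open>mConst ?c * _ \<in> J\<close>] mpolys_mult) auto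
      moreover have "mConst (1 / ?c) * mConst ?c = (1 :: ('v, 'a) mpoly)"
        using f by (simp add: mConst_def mult_single)
      ultimately show ?thesis
        by (metis mult.assoc mult_1_right)
    qed
    then have "(\<Sum>D\<in>Pow V. p * lagrange_poly V D) \<in> J"
      by (intro mpoly_ideal_sum[OF J]) auto
    then show "p \<in> J"
      by (simp add: sum_lagrange_poly[OF assms(1)] flip: sum_distrib_left)
  qed
qed

section \<open>Dimension of quotient spaces\<close>

text \<open>First isomorphism theorem, read from \<open>W\<close> to the quotient: a vector of
  \<open>W\<close> goes to its fibre under \<open>T\<close>, and fibres are exactly the cosets of
  the kernel. In this direction only \<open>W\<close> has to be finite-dimensional.\<close>

lemma (in linear_map) dim_quotient_space:
  assumes surj: "T ` carrier V = carrier W" and "vectorspace.fin_dim K W"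
  shows "vectorspace.dim K (quotient_space V ker) = vectorspace.dim K W"
proof -
  let ?Q = "quotient_space V ker"
  define F where "F y = {x \<in> carrier V. T x = y}" for y
  have ker: "ker = F \<zero>\<^bsub>W\<^esub>"
    by (simp add: ker_def F_def)
  have coset: "ker +>\<^bsub>V\<^esub> a = F (T a)" if a: "a \<in> carrier V" for a
  proof (intro equalityI subsetI)
    fix x assume "x \<in> ker +>\<^bsub>V\<^esub> a"
    then show "x \<in> F (T a)"
      using a by (auto simp: a_r_coset_def' ker_def F_def)
  next
    fix x assume "x \<in> F (T a)"
    then have x: "x \<in> carrier V" "T x = T a" by (auto simp: F_def)
    have "x = (x \<ominus>\<^bsub>V\<^esub> a) \<oplus>\<^bsub>V\<^esub> a"
      using x a by (simp add: a_minus_def V.module.M.a_assoc V.module.M.l_neg)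
    moreover have "x \<ominus>\<^bsub>V\<^esub> a \<in> ker"
      using x a by (simp add: ker_def T_minus W.module.M.r_neg a_minus_def)
    ultimately show "x \<in> ker +>\<^bsub>V\<^esub> a"
      by (auto simp: a_r_coset_def')
  qed
  have F_add: "F y <+>\<^bsub>V\<^esub> F z = F (y \<oplus>\<^bsub>W\<^esub> z)" if y: "y \<in> carrier W" and z: "z \<in> carrier W" for y z
  proof (intro equalityI subsetI)
    fix x assume "x \<in> F y <+>\<^bsub>V\<^esub> F z"
    then show "x \<in> F (y \<oplus>\<^bsub>W\<^esub> z)"
      by (auto simp: set_add_def' F_def)
  next
    fix x assume "x \<in> F (y \<oplus>\<^bsub>W\<^esub> z)"
    then have x: "x \<in> carrier V" "T x = y \<oplus>\<^bsub>W\<^esub> z" by (auto simp: F_def)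
    obtain b where b: "b \<in> carrier V" "T b = z"
      using z surj[symmetric] by (auto simp only: image_iff)
    have "x \<ominus>\<^bsub>V\<^esub> b \<in> F y"
      using x b y z by (simp add: F_def T_minus a_minus_def W.module.M.a_assoc W.module.M.r_neg)
    moreover have "b \<in> F z"
      using b by (simp add: F_def)
    moreover have "x = (x \<ominus>\<^bsub>V\<^esub> b) \<oplus>\<^bsub>V\<^esub> b"
      using x b by (simp add: a_minus_def V.module.M.a_assoc V.module.M.l_neg)
    ultimately show "x \<in> F y <+>\<^bsub>V\<^esub> F z"
      by (auto simp: set_add_def')
  qed
  have carrier_Q: "carrier ?Q = F ` carrier W"
  proof -
    have "carrier ?Q = (\<lambda>a. ker +>\<^bsub>V\<^esub> a) ` carrier V"
      by (auto simp: quotient_space_def A_RCOSETS_def')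
    also have "\<dots> = F ` T ` carrier V"
      unfolding image_image by (intro image_cong refl coset)
    finally show ?thesis by (simp add: surj)
  qed
  have add_Q: "F y \<oplus>\<^bsub>?Q\<^esub> F z = F (y \<oplus>\<^bsub>W\<^esub> z)" if "y \<in> carrier W" "z \<in> carrier W" for y z
    using F_add[OF that] by (simp add: quotient_space_def)
  have smult_Q: "c \<odot>\<^bsub>?Q\<^esub> F y = F (c \<odot>\<^bsub>W\<^esub> y)" if c: "c \<in> carrier K" and y: "y \<in> carrier W" for c y
  proof -
    \<comment> \<open>Scalar multiplication in the quotient is a union over representatives; it is a
      single coset because all of them give the same one and there is at least one.\<close>
    obtain b where b: "b \<in> F y"
      using y surj[symmetric] by (auto simp: F_def)
    have "ker +>\<^bsub>V\<^esub> (c \<odot>\<^bsub>V\<^esub> x) = F (c \<odot>\<^bsub>W\<^esub> y)" if "x \<in> F y" for x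
      using that c by (auto simp: F_def coset)
    then show ?thesis
      using b by (auto simp: quotient_space_def)
  qed
  have zero_Q: "\<zero>\<^bsub>?Q\<^esub> = F \<zero>\<^bsub>W\<^esub>"
    by (simp add: quotient_space_def ker)
  have inj: "inj_on F (carrier W)"
  proof (rule inj_onI)
    fix y z assume "y \<in> carrier W" "z \<in> carrier W" "F y = F z"
    moreover from this obtain b where "b \<in> carrier V" "T b = y"
      using surj[symmetric] by (auto simp only: image_iff)
    ultimately show "y = z" by (auto simp: F_def)
  qed
  \<comment> \<open>The vector space laws of the quotient are carried over from \<open>W\<close>
    along \<open>F\<close>, which is onto and respects the operations.\<close>
  have vs: "vectorspace K ?Q"
  proof (rule vs_criteria)
    show "\<forall>v\<in>carrier ?Q. \<exists>neg_v\<in>carrier ?Q. v \<oplus>\<^bsub>?Q\<^esub> neg_v = \<zero>\<^bsub>?Q\<^esub>"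
    proof
      fix v assume "v \<in> carrier ?Q"
      then obtain y where "y \<in> carrier W" "v = F y" by (auto simp: carrier_Q)
      then show "\<exists>neg_v\<in>carrier ?Q. v \<oplus>\<^bsub>?Q\<^esub> neg_v = \<zero>\<^bsub>?Q\<^esub>"
        by (intro bexI[of _ "F (\<ominus>\<^bsub>W\<^esub> y)"])
          (auto simp: carrier_Q add_Q zero_Q W.module.M.r_neg)
    qed
    show "field K" ..
  qed (auto simp: carrier_Q add_Q smult_Q zero_Q W.module.M.a_ac W.module.smult_assoc1
      W.module.smult_l_distr W.module.smult_r_distr)
  interpret Q: linear_map K W ?Q F
  proof (intro linear_map.intro mod_hom.intro mod_hom_axioms.intro vs)
    show "vectorspace K W" ..
    show "module K W" ..
    show "module K ?Q" by (rule vectorspace.axioms(1)[OF vs])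
    show "F \<in> LinearCombinations.module_hom K W ?Q"
      by (auto simp: LinearCombinations.module_hom_def carrier_Q add_Q smult_Q)
  qed
  show ?thesis
    using Q.dim_eq[OF assms(2) inj] by (simp add: carrier_Q)
qed

section \<open>The Hilbert function of a vanishing ideal\<close>

lemma vectorspace_mpoly_space: "vectorspace class_ring (mpoly_space V s)"
proof (rule vs_criteria)
  let ?K = "class_ring :: complex ring"
  show "\<forall>v\<in>carrier (mpoly_space V s). \<exists>neg_v\<in>carrier (mpoly_space V s).
      v \<oplus>\<^bsub>mpoly_space V s\<^esub> neg_v = \<zero>\<^bsub>mpoly_space V s\<^esub>"
  proof
    fix p assume "p \<in> carrier (mpoly_space V s)"
    moreover have "mConst (- 1) * p = - p"
      by (simp add: mConst_def single_uminus)
    ultimately show "\<exists>q\<in>carrier (mpoly_space V s).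
        p \<oplus>\<^bsub>mpoly_space V s\<^esub> q = \<zero>\<^bsub>mpoly_space V s\<^esub>"
      using mpolys_le_mult[of "mConst (-1)" V 0 p s]
      by (intro bexI[of _ "- p"]) (simp_all add: mpoly_space_def)
  qed
  show "field ?K" by (rule class_field)
  show "\<forall>c p. c \<in> carrier ?K \<and> p \<in> carrier (mpoly_space V s) \<longrightarrow>
      c \<odot>\<^bsub>mpoly_space V s\<^esub> p \<in> carrier (mpoly_space V s)"
    using mpolys_le_mult[of "mConst _" V 0 _ s] by (auto simp: mpoly_space_def)
  show "\<forall>a b p. a \<in> carrier ?K \<and> b \<in> carrier ?K \<and>
      p \<in> carrier (mpoly_space V s) \<longrightarrow>
      (a \<otimes>\<^bsub>?K\<^esub> b) \<odot>\<^bsub>mpoly_space V s\<^esub> p =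
      a \<odot>\<^bsub>mpoly_space V s\<^esub> (b \<odot>\<^bsub>mpoly_space V s\<^esub> p)"
    by (simp add: mpoly_space_def mConst_def mult_single flip: mult.assoc)
qed (auto simp: mpoly_space_def mpolys_le_add algebra_simps mConst_def single_add)

text \<open>Evaluation at the points of \<open>Z\<close> is a linear map from the polynomials of
  degree at most \<open>s\<close> to the vectors of length \<open>card Z\<close>. Its kernel is the
  degree-\<open>s\<close> part of the ideal, and it is onto once the Lagrange polynomials fit below
  \<open>s\<close>.\<close>

theorem affine_hilbert_function_boolean:
  assumes "finite V" "Z \<subseteq> Pow V" "card V \<le> s"
  shows "affine_hilbert_function V {p \<in> mpolys V. \<forall>x\<in>boolean_point ` Z. mpoly_eval x p = 0} s = card Z"
proof -
  let ?K = "class_ring :: complex ring" and ?n = "card Z"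
  let ?M = "mpoly_space V s" and ?W = "module_vec TYPE(complex) ?n"
  have "finite Z" using assms finite_subset by blast
  then obtain h where h: "bij_betw h {..<?n} Z"
    using bij_betw_from_nat_into_finite by blast
  define T where "T p = vec ?n (\<lambda>i. mpoly_eval (boolean_point (h i)) p)"
    for p :: "('a, complex) mpoly"
  interpret W: vec_space "TYPE(complex)" ?n .
  interpret linear_map ?K ?M ?W T
  proof (intro linear_map.intro mod_hom.intro mod_hom_axioms.intro vectorspace_mpoly_space)
    show "vectorspace ?K ?W" ..
    show "module ?K ?W" ..
    show "module ?K ?M"
      by (rule vectorspace.axioms(1)[OF vectorspace_mpoly_space])
    show "T \<in> LinearCombinations.module_hom ?K ?M ?W"
      by (auto simp: LinearCombinations.module_hom_def mpoly_space_def module_vec_def T_def)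
  qed
  have surj: "T ` carrier ?M = carrier ?W"
  proof (intro equalityI subsetI)
    fix v assume "v \<in> T ` carrier ?M"
    then show "v \<in> carrier ?W" by (auto simp: T_def module_vec_def)
  next
    fix v assume "v \<in> carrier ?W"
    then have v: "v \<in> carrier_vec ?n" by (simp add: module_vec_def)
    \<comment> \<open>Lagrange interpolation of the prescribed values \<open>v\<close>.\<close>
    define p where "p = (\<Sum>j<?n. mConst (v $ j) * lagrange_poly V (h j))"
    have hZ: "h j \<subseteq> V" if "j < ?n" for j
      using bij_betwE[OF h] that assms(2) by blast
    have "lagrange_poly V (h j) \<in> mpolys_le V s" if "j < ?n" for j
      using lagrange_poly_in_mpolys_le[OF assms(1) hZ[OF that]] mpolys_le_mono[OF assms(3)] by blast
    then have "p \<in> carrier ?M"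
      unfolding p_def mpoly_space_def using mpolys_le_mult[of "mConst _" V 0 _ s]
      by (auto intro!: mpolys_le_sum)
    moreover have "T p = v"
    proof (rule eq_vecI)
      fix i assume "i < dim_vec v"
      then have i: "i < ?n" using v by simp
      have "mpoly_eval (boolean_point (h i)) p = (\<Sum>j<?n. v $ j * of_bool (h i = h j))"
        unfolding p_def using i by (auto simp: eval_lagrange_poly[OF assms(1)] hZ intro!: sum.cong)
      \<comment> \<open>Injectivity of the enumeration \<open>h\<close> turns equality of points
        into equality of indices.\<close>
      also have "\<dots> = (\<Sum>j<?n. if j = i then v $ j else 0)"
        using i h by (intro sum.cong) (auto simp: bij_betw_def inj_on_def)
      finally show "T p $ i = v $ i"
        using i by (simp add: T_def)
    qed (use v in \<open>simp add: T_def\<close>)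
    ultimately show "v \<in> T ` carrier ?M" by blast
  qed
  have all: "(\<forall>i<?n. mpoly_eval (boolean_point (h i)) p = 0) \<longleftrightarrow>
      (\<forall>D\<in>Z. mpoly_eval (boolean_point D) p = 0)" for p :: "('a, complex) mpoly"
    by (subst bij_betw_imp_surj_on[OF h, symmetric]) auto
  have "ker = {p \<in> mpolys_le V s. \<forall>i<?n. mpoly_eval (boolean_point (h i)) p = 0}"
    unfolding ker_def by (auto simp: mpoly_space_def module_vec_def T_def vec_eq_iff)
  also have "\<dots> = {p \<in> mpolys V. \<forall>x\<in>boolean_point ` Z. mpoly_eval x p = 0} \<inter> mpolys_le V s"
    using mpolys_le_subset[of V s] by (auto simp: all)
  finally show ?thesis
    using dim_quotient_space[OF surj W.fin_dim] W.dim_is_n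
    by (simp add: affine_hilbert_function_def)
qed

section \<open>Characters of a product of cyclic groups\<close>

lemma power_eq_if_root_of_unity:
  fixes z :: "'a::comm_monoid_mult"
  assumes "z ^ n = 1" "a mod n = b mod n"
  shows "z ^ a = z ^ b"
proof -
  have "z ^ c = z ^ (c mod n)" for c
    using assms(1) by (metis power_add power_mult power_one mult_1 mult_div_mod_eq)
  then show ?thesis using assms(2) by metis
qed

text \<open>Multiplication by a primitive root \<open>w\<close> permutes the roots of unity and
  scales the sum by \<open>w ^ m\<close>, which is not 1.\<close>

lemma sum_power_roots_unity:
  assumes "0 < m" "m < n"
  shows "(\<Sum>z | z ^ n = 1. z ^ m) = (0::complex)"
proof -
  define w where "w = cis (2 * pi * real 1 / real n)"
  have bij: "bij_betw (\<lambda>k. cis (2 * pi * real k / real n)) {..<n} {z. z ^ n = 1}"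
    using assms by (intro bij_betw_roots_unity) auto
  have wm: "w ^ m = cis (2 * pi * real m / real n)"
    by (simp add: w_def DeMoivre mult_ac)
  have "w ^ m \<noteq> 1"
  proof
    assume "w ^ m = 1"
    \<comment> \<open>Otherwise the distinct indices \<open>m\<close> and 0, both below
      \<open>n\<close>, would give the same root.\<close>
    then have "cis (2 * pi * real m / real n) = cis (2 * pi * real 0 / real n)"
      by (simp add: wm)
    from inj_onD[OF bij_betw_imp_inj_on[OF bij] this] show False
      using assms by simp
  qed
  have "w \<noteq> 0" by (simp add: w_def)
  have "w ^ n = 1"
    using assms by (simp add: w_def DeMoivre)
  have "(\<Sum>z | z ^ n = 1. z ^ m) = (\<Sum>z | z ^ n = 1. (w * z) ^ m)"
    using \<open>w ^ n = 1\<close> \<open>w \<noteq> 0\<close>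
    by (intro sum.reindex_bij_witness[of _ "\<lambda>z. w * z" "\<lambda>z. z / w"])
      (auto simp: power_mult_distrib power_divide)
  also have "\<dots> = w ^ m * (\<Sum>z | z ^ n = 1. z ^ m)"
    by (simp add: power_mult_distrib sum_distrib_left)
  finally show ?thesis
    using \<open>w ^ m \<noteq> 1\<close> by simp
qed

text \<open>Positive moduli exclude \<open>integer_mod_group 0\<close>, the infinite group of
  integers, and make every factor a set of standard representatives.\<close>

locale cyclic_factors =
  fixes t :: nat and n :: "nat \<Rightarrow> nat"
  assumes n_pos: "l \<in> {1..t} \<Longrightarrow> n l \<ge> 1"
begin

abbreviation "G \<equiv> cyclic_product t n"

sublocale G: Group.group G
  unfolding cyclic_product_def by (rule product_group) simp

lemma carrier_G: "carrier G = (\<Pi>\<^sub>E l\<in>{1..t}. {0..<int (n l)})"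
proof -
  have "carrier (integer_mod_group (n l)) = {0..<int (n l)}" if "l \<in> {1..t}" for l
    using n_pos[OF that] by (simp add: carrier_integer_mod_group)
  then show ?thesis
    unfolding cyclic_product_def carrier_product_group by (intro PiE_cong)
qed

lemma finite_G: "finite (carrier G)"
  unfolding carrier_G by (intro finite_PiE) auto

lemma one_G: "\<one>\<^bsub>G\<^esub> = (\<lambda>l\<in>{1..t}. 0)"
  by (simp add: cyclic_product_def)

lemma mult_inv_G:
  assumes "x \<in> carrier G" "y \<in> carrier G"
  shows "x \<otimes>\<^bsub>G\<^esub> inv\<^bsub>G\<^esub> y = (\<lambda>l\<in>{1..t}. (x l - y l) mod int (n l))"
proof -
  have "inv\<^bsub>G\<^esub> y = (\<lambda>l\<in>{1..t}. inv\<^bsub>integer_mod_group (n l)\<^esub> y l)"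
    using assms unfolding cyclic_product_def by (intro inv_product_group) auto
  also have "\<dots> = (\<lambda>l\<in>{1..t}. (- y l) mod int (n l))"
    using assms(2) unfolding cyclic_product_def
    by (intro restrict_ext inv_integer_mod_group) (auto simp: PiE_def Pi_def)
  finally show ?thesis
    by (auto simp: cyclic_product_def mod_add_right_eq)
qed

definition character :: "(nat \<Rightarrow> complex) \<Rightarrow> (nat \<Rightarrow> int) \<Rightarrow> complex" where
  "character \<xi> x = (\<Prod>l=1..t. \<xi> l ^ nat (x l))"

text \<open>The exponents are those of the second factor of \<open>Psi\<close>. On
  \<open>root_tuples t n\<close> this is the inverse character; a coordinate 0 gets exponent
  \<open>n l\<close>, which also yields 1.\<close>

definition conj_character :: "(nat \<Rightarrow> complex) \<Rightarrow> (nat \<Rightarrow> int) \<Rightarrow> complex" where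
  "conj_character \<xi> x = (\<Prod>l=1..t. \<xi> l ^ (n l - nat (x l)))"

lemma character_one [simp]: "character \<xi> \<one>\<^bsub>G\<^esub> = 1"
  by (simp add: character_def one_G)

lemma character_mult_conj_character:
  assumes "\<xi> \<in> root_tuples t n" "x \<in> carrier G" "y \<in> carrier G"
  shows "character \<xi> x * conj_character \<xi> y = character \<xi> (x \<otimes>\<^bsub>G\<^esub> inv\<^bsub>G\<^esub> y)"
proof -
  have "\<xi> l ^ nat (x l) * \<xi> l ^ (n l - nat (y l)) = \<xi> l ^ nat ((x l - y l) mod int (n l))"
    if l: "l \<in> {1..t}" for l
  proof -
    have xy: "0 \<le> x l" "x l < int (n l)" "0 \<le> y l" "y l < int (n l)"
      using assms(2,3) l by (auto simp: carrier_G PiE_def Pi_def)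
    \<comment> \<open>The natural subtraction does not truncate because \<open>y l < n l\<close>, so
      over the integers the exponent differs from \<open>x l - y l\<close> by exactly
      \<open>n l\<close>.\<close>
    have "int (nat (x l) + (n l - nat (y l))) = (x l - y l) + int (n l)"
      using xy by (simp add: of_nat_diff)
    then have "int (nat (x l) + (n l - nat (y l))) mod int (n l) = (x l - y l) mod int (n l)"
      by simp
    also have "\<dots> = int (nat ((x l - y l) mod int (n l))) mod int (n l)"
      using xy by simp
    finally have "(nat (x l) + (n l - nat (y l))) mod n l = nat ((x l - y l) mod int (n l)) mod n l"
      by (metis of_nat_eq_iff of_nat_mod)
    moreover have "\<xi> l ^ n l = 1"
      using assms(1) l by (simp add: root_tuples_def)
    ultimately show ?thesis
      unfolding power_add[symmetric] by (intro power_eq_if_root_of_unity)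
  qed
  then show ?thesis
    unfolding character_def conj_character_def mult_inv_G[OF assms(2,3)]
    by (simp flip: prod.distrib)
qed

text \<open>Orthogonality: the tuples form a product set, so the sum factors into one sum over roots
  of unity per coordinate. At the identity each factor counts \<open>n l\<close> roots; otherwise a
  nonzero coordinate makes its factor vanish.\<close>

lemma sum_character:
  assumes "x \<in> carrier G"
  shows "(\<Sum>\<xi>\<in>root_tuples t n. character \<xi> x) = (if x = \<one>\<^bsub>G\<^esub> then of_nat (\<Prod>l=1..t. n l) else 0)"
proof -
  have U: "root_tuples t n = (\<Pi>\<^sub>E l\<in>{1..t}. {z. z ^ n l = 1})"
    by (auto simp: root_tuples_def PiE_def Pi_def)
  have "(\<Sum>\<xi>\<in>root_tuples t n. character \<xi> x) = (\<Prod>l=1..t. \<Sum>z | z ^ n l = 1. z ^ nat (x l))"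
    unfolding U character_def using n_pos
    by (intro prod_sum_PiE[symmetric]) (auto intro!: finite_roots_unity)
  also have "\<dots> = (if x = \<one>\<^bsub>G\<^esub> then of_nat (\<Prod>l=1..t. n l) else 0)"
  proof (cases "x = \<one>\<^bsub>G\<^esub>")
    case True
    then have "(\<Sum>z | z ^ n l = 1. z ^ nat (x l)) = (of_nat (n l) :: complex)" if "l \<in> {1..t}" for l
      using that n_pos[OF that] by (simp add: one_G card_roots_unity_eq)
    then show ?thesis using True by simp
  next
    case False
    have "\<exists>l\<in>{1..t}. x l \<noteq> 0"
    proof (rule ccontr)
      assume "\<not> (\<exists>l\<in>{1..t}. x l \<noteq> 0)"
      then have "x = \<one>\<^bsub>G\<^esub>"
        using assms unfolding one_G carrier_G by (auto simp: PiE_iff extensional_def)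
      with False show False by simp
    qed
    then obtain l where l: "l \<in> {1..t}" "x l \<noteq> 0" by blast
    then have "0 \<le> x l" "x l < int (n l)"
      using assms by (auto simp: carrier_G PiE_def Pi_def)
    then have "(\<Sum>z | z ^ n l = 1. z ^ nat (x l)) = (0::complex)"
      using l by (intro sum_power_roots_unity) auto
    then have "(\<Prod>l=1..t. \<Sum>z | z ^ n l = 1. z ^ nat (x l)) = (0::complex)"
      using l by (intro prod_zero) auto
    then show ?thesis using False by simp
  qed
  finally show ?thesis .
qed

lemma quotient_eq_one_iff:
  assumes "x \<in> carrier G" "y \<in> carrier G"
  shows "x \<otimes>\<^bsub>G\<^esub> inv\<^bsub>G\<^esub> y = \<one>\<^bsub>G\<^esub> \<longleftrightarrow> x = y"
  using assms G.inv_solve_right' by force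

text \<open>Fourier inversion: multiplying by the inverse character at \<open>y\<close> and summing
  over all \<open>\<xi>\<close> isolates \<open>f y\<close>, up to the nonzero factor
  \<open>?N\<close>.\<close>

lemma fourier_injective:
  assumes "\<And>\<xi>. \<xi> \<in> root_tuples t n \<Longrightarrow> (\<Sum>x\<in>carrier G. f x * character \<xi> x) = 0"
    and y: "y \<in> carrier G"
  shows "f y = 0"
proof -
  let ?N = "of_nat (\<Prod>l=1..t. n l) :: complex"
  have "0 = (\<Sum>\<xi>\<in>root_tuples t n. (\<Sum>x\<in>carrier G. f x * character \<xi> x) * conj_character \<xi> y)"
    using assms(1) by simp
  also have "\<dots> = (\<Sum>\<xi>\<in>root_tuples t n. \<Sum>x\<in>carrier G. f x * character \<xi> (x \<otimes>\<^bsub>G\<^esub> inv\<^bsub>G\<^esub> y))"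
    using y by (simp add: sum_distrib_right mult.assoc character_mult_conj_character cong: sum.cong)
  also have "\<dots> = (\<Sum>x\<in>carrier G. f x * (\<Sum>\<xi>\<in>root_tuples t n. character \<xi> (x \<otimes>\<^bsub>G\<^esub> inv\<^bsub>G\<^esub> y)))"
    by (subst sum.swap) (simp add: sum_distrib_left)
  also have "\<dots> = (\<Sum>x\<in>carrier G. if x = y then f x * ?N else 0)"
    using y by (intro sum.cong refl) (auto simp: sum_character quotient_eq_one_iff)
  also have "\<dots> = f y * ?N"
    using y finite_G by simp
  finally have "f y * ?N = 0" by simp
  moreover have "n l \<noteq> 0" if "l \<in> {1..t}" for l
    using n_pos[OF that] by simp
  ultimately show ?thesis by auto
qed


section \<open>Difference sets as zeros\<close>

text \<open>The coefficient of \<open>g\<close> in the product of \<open>D\<close> and its inverse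
  in the group ring.\<close>

definition quotient_count :: "(nat \<Rightarrow> int) set \<Rightarrow> (nat \<Rightarrow> int) \<Rightarrow> nat" where
  "quotient_count D g = card {(g1, g2). g1 \<in> D \<and> g2 \<in> D \<and> g1 \<otimes>\<^bsub>G\<^esub> inv\<^bsub>G\<^esub> g2 = g}"

lemma quotient_count_one:
  assumes "D \<subseteq> carrier G"
  shows "quotient_count D \<one>\<^bsub>G\<^esub> = card D"
proof -
  have "{(g1, g2). g1 \<in> D \<and> g2 \<in> D \<and> g1 \<otimes>\<^bsub>G\<^esub> inv\<^bsub>G\<^esub> g2 = \<one>\<^bsub>G\<^esub>} = (\<lambda>g. (g, g)) ` D"
    using assms by (auto simp: quotient_eq_one_iff[OF subsetD subsetD])
  then show ?thesis
    by (simp add: quotient_count_def card_image inj_on_def)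
qed

text \<open>The cardinality condition becomes the case of the identity, where
  \<open>quotient_count\<close> is \<open>card D\<close> and the right-hand side is
  \<open>lam + (k - lam) = k\<close>. Thus one equation covers all of the group.\<close>

lemma difference_set_iff:
  "difference_set G (Coset.order G) k lam D \<longleftrightarrow> D \<subseteq> carrier G \<and>
    (\<forall>g\<in>carrier G. int (quotient_count D g) = lam + (if g = \<one>\<^bsub>G\<^esub> then k - lam else 0))"
  unfolding difference_set_def quotient_count_def[symmetric]
  using quotient_count_one[of D] by (auto split: if_splits)

lemma Psi_at_in_mpolys: "Psi_at t n k lam \<xi> \<in> mpolys (carrier G)"
  unfolding Psi_at_def Psi_def
  \<comment> \<open>Substituting for the X-variables first leaves an explicit polynomial in the
    A-variables; \<open>of_int (k - lam)\<close> stays unsplit so that it is recognised as a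
    constant.\<close>
  by (simp only: mpoly_eval_diff mpoly_eval_mult mpoly_eval_sum mpoly_eval_prod mpoly_eval_power
      mpoly_eval_mConst mpoly_eval_mVar mpoly_eval_of_int)
    (intro mpolys_diff mpolys_mult mpolys_sum mpolys_prod mpolys_power; simp del: of_int_diff)

text \<open>Identifies the value as a Fourier transform on the group: the product of the two sums
  gives the counts, and the constant \<open>k - lam\<close> is the transform of a function supported
  at the identity.\<close>

lemma eval_Psi_at:
  assumes D: "D \<subseteq> carrier G" and \<xi>: "\<xi> \<in> root_tuples t n"
  shows "mpoly_eval (boolean_point D) (Psi_at t n k lam \<xi>) =
    (\<Sum>g\<in>carrier G. (of_nat (quotient_count D g) - of_int lam -
      (if g = \<one>\<^bsub>G\<^esub> then of_int (k - lam) else 0)) * character \<xi> g)"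
proof -
  have finite: "finite D" using D finite_G finite_subset by blast
  have "mpoly_eval (boolean_point D) (Psi_at t n k lam \<xi>) =
      (\<Sum>g\<in>carrier G. of_bool (g \<in> D) * character \<xi> g) *
      (\<Sum>g\<in>carrier G. of_bool (g \<in> D) * conj_character \<xi> g) -
      of_int lam * (\<Sum>g\<in>carrier G. character \<xi> g) - of_int (k - lam)"
    by (simp add: Psi_at_def Psi_def character_def conj_character_def)
  moreover have "(\<Sum>g\<in>carrier G. of_bool (g \<in> D) * character \<xi> g) = (\<Sum>g\<in>D. character \<xi> g)"
    using D finite_G by (intro sum.mono_neutral_cong_right) auto
  moreover have "(\<Sum>g\<in>carrier G. of_bool (g \<in> D) * conj_character \<xi> g) = (\<Sum>g\<in>D. conj_character \<xi> g)"
    using D finite_G by (intro sum.mono_neutral_cong_right) auto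
  moreover have "(\<Sum>g\<in>D. character \<xi> g) * (\<Sum>g\<in>D. conj_character \<xi> g) =
      (\<Sum>g\<in>carrier G. of_nat (quotient_count D g) * character \<xi> g)"
  proof -
    have "(\<Sum>g\<in>D. character \<xi> g) * (\<Sum>g\<in>D. conj_character \<xi> g) =
        (\<Sum>(g1, g2)\<in>D \<times> D. character \<xi> (g1 \<otimes>\<^bsub>G\<^esub> inv\<^bsub>G\<^esub> g2))"
      unfolding sum_product sum.cartesian_product
      using D by (intro sum.cong refl) (auto intro!: character_mult_conj_character[OF \<xi>])
    \<comment> \<open>The pairs of elements of \<open>D\<close> are grouped by their quotient
      \<open>g\<close>, on which alone the summand depends.\<close>
    also have "\<dots> = (\<Sum>g\<in>carrier G. \<Sum>p | p \<in> D \<times> D \<and> fst p \<otimes>\<^bsub>G\<^esub> inv\<^bsub>G\<^esub> snd p = g.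
        character \<xi> (fst p \<otimes>\<^bsub>G\<^esub> inv\<^bsub>G\<^esub> snd p))"
      unfolding case_prod_beta using D finite finite_G
      by (intro sum.group[symmetric]) (auto intro!: G.m_closed G.inv_closed)
    also have "\<dots> = (\<Sum>g\<in>carrier G. of_nat (quotient_count D g) * character \<xi> g)"
    proof (intro sum.cong refl)
      fix g
      have "{p. p \<in> D \<times> D \<and> fst p \<otimes>\<^bsub>G\<^esub> inv\<^bsub>G\<^esub> snd p = g} =
          {(g1, g2). g1 \<in> D \<and> g2 \<in> D \<and> g1 \<otimes>\<^bsub>G\<^esub> inv\<^bsub>G\<^esub> g2 = g}"
        by auto
      moreover have "(\<Sum>p | p \<in> D \<times> D \<and> fst p \<otimes>\<^bsub>G\<^esub> inv\<^bsub>G\<^esub> snd p = g.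
          character \<xi> (fst p \<otimes>\<^bsub>G\<^esub> inv\<^bsub>G\<^esub> snd p)) =
          (\<Sum>p | p \<in> D \<times> D \<and> fst p \<otimes>\<^bsub>G\<^esub> inv\<^bsub>G\<^esub> snd p = g. character \<xi> g)"
        by (intro sum.cong) auto
      ultimately show "(\<Sum>p | p \<in> D \<times> D \<and> fst p \<otimes>\<^bsub>G\<^esub> inv\<^bsub>G\<^esub> snd p = g.
          character \<xi> (fst p \<otimes>\<^bsub>G\<^esub> inv\<^bsub>G\<^esub> snd p)) = of_nat (quotient_count D g) * character \<xi> g"
        by (simp only: sum_constant quotient_count_def)
    qed
    finally show ?thesis .
  qed
  moreover have "(\<Sum>g\<in>carrier G. (if g = \<one>\<^bsub>G\<^esub> then of_int (k - lam) else 0) * character \<xi> g) =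
      of_int (k - lam)"
    using finite_G by (simp add: if_distrib[of "\<lambda>c. c * _"] cong: if_cong)
  ultimately show ?thesis
    by (simp add: left_diff_distrib sum_subtractf sum_distrib_left)
qed

lemma difference_set_iff_zero:
  assumes D: "D \<subseteq> carrier G"
  shows "difference_set G (Coset.order G) k lam D \<longleftrightarrow>
    (\<forall>\<xi>\<in>root_tuples t n. mpoly_eval (boolean_point D) (Psi_at t n k lam \<xi>) = 0)"
proof -
  define f :: "(nat \<Rightarrow> int) \<Rightarrow> complex" where
    "f g = of_nat (quotient_count D g) - of_int lam -
      (if g = \<one>\<^bsub>G\<^esub> then of_int (k - lam) else 0)" for g
  \<comment> \<open>As the image of an integer, \<open>f g\<close> vanishes exactly when the integer
    equation of \<open>difference_set_iff\<close> holds.\<close>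
  have "f g = of_int (int (quotient_count D g) - (lam + (if g = \<one>\<^bsub>G\<^esub> then k - lam else 0)))" for g
    by (simp add: f_def)
  then have "f g = 0 \<longleftrightarrow> int (quotient_count D g) = lam + (if g = \<one>\<^bsub>G\<^esub> then k - lam else 0)" for g
    by (simp only: of_int_eq_0_iff right_minus_eq)
  then have "difference_set G (Coset.order G) k lam D \<longleftrightarrow> (\<forall>g\<in>carrier G. f g = 0)"
    using D by (simp add: difference_set_iff)
  also have "\<dots> \<longleftrightarrow> (\<forall>\<xi>\<in>root_tuples t n. (\<Sum>g\<in>carrier G. f g * character \<xi> g) = 0)"
    (is "?L \<longleftrightarrow> ?R")
  proof
    show ?R if ?L using that by simp
    show ?L if ?R by (intro ballI fourier_injective[of f] bspec[OF that])
  qed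
  finally show ?thesis
    by (simp add: eval_Psi_at[OF D] f_def)
qed

lemma difference_set_ideal_eq:
  "difference_set_ideal t n k lam = {p \<in> mpolys (carrier G).
    \<forall>x\<in>boolean_point ` {D. difference_set G (Coset.order G) k lam D}. mpoly_eval x p = 0}"
proof -
  have "{D \<in> Pow (carrier G). \<forall>f\<in>Psi_at t n k lam ` root_tuples t n.
      mpoly_eval (boolean_point D) f = 0} = {D. difference_set G (Coset.order G) k lam D}"
    (is "?L = ?R")
  proof (rule Set.set_eqI)
    fix D
    have "D \<subseteq> carrier G" if "D \<in> ?R"
      using that by (simp add: difference_set_def)
    then show "D \<in> ?L \<longleftrightarrow> D \<in> ?R"
      using difference_set_iff_zero[of D k lam] by auto
  qed
  then show ?thesis
    unfolding difference_set_ideal_def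
    using genideal_boolean[OF finite_G, of "Psi_at t n k lam ` root_tuples t n"]
    by (simp add: image_subset_iff Psi_at_in_mpolys)
qed

end

theorem theorem2p1:
  fixes t v :: nat and n :: "nat \<Rightarrow> nat" and k lam :: int
  assumes "\<And>l. l \<in> {1..t} \<Longrightarrow> n l \<ge> 1"
    and "Coset.order (cyclic_product t n) = v"
  shows "\<forall>s::complex.
    of_nat (card {D. difference_set (cyclic_product t n) v k lam D}) =
    poly (affine_hilbert_poly (carrier (cyclic_product t n)) (difference_set_ideal t n k lam)) s"
proof -
  interpret cyclic_factors t n
    by unfold_locales (rule assms(1))
  let ?Z = "{D. difference_set G v k lam D}"
  have "?Z \<subseteq> Pow (carrier G)"
    by (auto simp: difference_set_def)
  \<comment> \<open>From the order of the group on, the Hilbert function is constant, so the Hilbert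
    polynomial is the constant polynomial with that value.\<close>
  then have "affine_hilbert_function (carrier G) (difference_set_ideal t n k lam) s = card ?Z"
    if "s \<ge> card (carrier G)" for s
    unfolding difference_set_ideal_eq assms(2)
    by (rule affine_hilbert_function_boolean[OF finite_G _ that])
  then have "affine_hilbert_poly (carrier G) (difference_set_ideal t n k lam) = [:of_nat (card ?Z):]"
    by (intro affine_hilbert_poly_eqI[of "card (carrier G)"]) simp
  then show ?thesis by simp
qed

end
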